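(* Let $\mathcal{H}$ be a complex Hilbert space and let $T\in\mathcal{B}(\mathcal{H})$. Then $$dw^2(T)\leq \inf_{\lambda\in\mathbb{C}}\Big\{\Big(2\left\|\mathrm{Re}(\lambda)\,\mathrm{Re}(T)+\mathrm{Im}(\lambda)\,\mathrm{Im}(T)\right\|+\left\|T^*T-2\,\mathrm{Re}(\overline{\lambda}T)\right\|\Big)^2+2\left\|\mathrm{Re}(\overline{\lambda}T)\right\|-|\lambda|^2+w^2(T-\lambda I)\Big\}.$$ In particular, $dw(T)\leq\sqrt{w^2(T)+\|T\|^4}$.
   Context: $\mathcal{B}(\mathcal{H})$ is the algebra of bounded linear operators on the complex Hilbert space $\mathcal{H}$, with operator norm $\|\cdot\|$ and identity $I$. For an operator $S\in\mathcal{B}(\mathcal{H})$, $\mathrm{Re}(S)=\frac{1}{2}(S+S^* )$ and $\mathrm{Im}(S)=\frac{1}{2\mathrm{i}}(S-S^* )$ (Cartesian decomposition $S=\mathrm{Re}(S)+\mathrm{i}\,\mathrm{Im}(S)$); for a scalar $\lambda$, $\mathrm{Re}(\lambda),\mathrm{Im}(\lambda)$ are its real and imaginary parts. The numerical radius is $w(T)=\sup\{|\langle Tx,x\rangle|: \|x\|=1\}$ and the Davis-Wielandt radius is $dw(T)=\sup\{\sqrt{|\langle Tx,x\rangle|^2+\|Tx\|^4}: \|x\|=1\}$, with $x$ ranging over unit vectors of $\mathcal{H}$. Powers such as $dw^2(T)$ mean $(dw(T))^2$, and similarly for $w^2$. *)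

theory Defs
  imports "HOL-Analysis.Analysis"
begin

text \<open>
  Complex inner product spaces are built on top of \<open>real_normed_vector\<close>, so that the library's
  norm, \<open>bounded_linear\<close> and \<open>onorm\<close> apply to them. The inner product is linear in its first
  argument. The law \<open>1 *\<^sub>C x = x\<close> follows from \<open>scaleR_scaleC\<close>.
\<close>

class complex_inner = real_normed_vector +
  fixes scaleC :: "complex \<Rightarrow> 'a \<Rightarrow> 'a"  (infixr \<open>*\<^sub>C\<close> 75)
    and cinner :: "'a \<Rightarrow> 'a \<Rightarrow> complex"
  assumes scaleR_scaleC: "r *\<^sub>R x = complex_of_real r *\<^sub>C x"
    and scaleC_add_right: "c *\<^sub>C (x + y) = c *\<^sub>C x + c *\<^sub>C y"
    and scaleC_add_left: "(c + d) *\<^sub>C x = c *\<^sub>C x + d *\<^sub>C x"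
    and scaleC_scaleC: "c *\<^sub>C (d *\<^sub>C x) = (c * d) *\<^sub>C x"
    and cinner_commute: "cinner x y = cnj (cinner y x)"
    and cinner_add_left: "cinner (x + y) z = cinner x z + cinner y z"
    and cinner_scaleC_left: "cinner (c *\<^sub>C x) y = c * cinner x y"
    and cinner_ge_zero: "0 \<le> Re (cinner x x)"
    and cinner_eq_zero_iff: "cinner x x = 0 \<longleftrightarrow> x = 0"
    and norm_eq_sqrt_cinner: "norm x = sqrt (Re (cinner x x))"

class chilbert_space = complex_inner + banach

instantiation complex :: chilbert_space
begin

definition scaleC_complex :: "complex \<Rightarrow> complex \<Rightarrow> complex"
  where "scaleC_complex c x = c * x"

definition cinner_complex :: "complex \<Rightarrow> complex \<Rightarrow> complex"
  where "cinner_complex x y = x * cnj y"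

instance
proof
  fix x :: complex
  show "norm x = sqrt (Re (cinner x x))"
    by (simp add: cinner_complex_def cmod_def power2_eq_square)
qed (auto simp: scaleC_complex_def cinner_complex_def scaleR_conv_of_real algebra_simps)

end

definition bounded_clinear :: "('a::complex_inner \<Rightarrow> 'b::complex_inner) \<Rightarrow> bool"
  where "bounded_clinear T \<longleftrightarrow> bounded_linear T \<and> (\<forall>c x. T (c *\<^sub>C x) = c *\<^sub>C T x)"

text \<open>
  For a bounded operator on a Hilbert space the adjoint exists by the Riesz representation theorem
  and is unique, so the choice below is determined.
\<close>

definition cadjoint :: "('a::complex_inner \<Rightarrow> 'a) \<Rightarrow> 'a \<Rightarrow> 'a"
  where "cadjoint T = (SOME S. \<forall>x y. cinner (T x) y = cinner x (S y))"

definition Re_op :: "('a::complex_inner \<Rightarrow> 'a) \<Rightarrow> 'a \<Rightarrow> 'a"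
  where "Re_op S = (\<lambda>x. (1 / 2) *\<^sub>C (S x + cadjoint S x))"

definition Im_op :: "('a::complex_inner \<Rightarrow> 'a) \<Rightarrow> 'a \<Rightarrow> 'a"
  where "Im_op S = (\<lambda>x. (1 / (2 * \<i>)) *\<^sub>C (S x - cadjoint S x))"

text \<open>
  The suprema are taken in the reals, so they are meaningful only if the space has a unit vector;
  on the zero space they are unspecified.
\<close>

definition numerical_radius :: "('a::complex_inner \<Rightarrow> 'a) \<Rightarrow> real"
  where "numerical_radius T = (SUP x\<in>{x. norm x = 1}. cmod (cinner (T x) x))"

definition davis_wielandt_radius :: "('a::complex_inner \<Rightarrow> 'a) \<Rightarrow> real"
  where "davis_wielandt_radius T =
    (SUP x\<in>{x. norm x = 1}. sqrt ((cmod (cinner (T x) x))\<^sup>2 + norm (T x) ^ 4))"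

end

theory Submission
  imports Defs
begin

text \<open>
  Write \<open>R\<close> for the real part of \<open>cnj \<mu> T\<close>, which equals \<open>Re \<mu> Re T + Im \<mu> Im T\<close>. For a unit
  vector \<open>x\<close> and \<open>a = \<langle>Tx, x\<rangle>\<close> we have
  \<open>\<bar>a\<bar>\<^sup>2 = \<bar>a - \<mu>\<bar>\<^sup>2 + 2 \<langle>Rx, x\<rangle> - \<bar>\<mu>\<bar>\<^sup>2\<close> and
  \<open>\<parallel>Tx\<parallel>\<^sup>2 = \<langle>(T\<^sup>*T - 2R)x, x\<rangle> + 2 \<langle>Rx, x\<rangle>\<close>, and each term is bounded by the corresponding norm or
  numerical radius.
\<close>

section \<open>Complex inner product spaces\<close>

lemma cinner_add_right: "cinner x (y + z) = cinner x y + cinner x z"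
  for x :: "'a::complex_inner"
  by (metis cinner_add_left cinner_commute complex_cnj_add)

lemma cinner_scaleC_right: "cinner x (c *\<^sub>C y) = cnj c * cinner x y"
  for x :: "'a::complex_inner"
  by (metis cinner_commute cinner_scaleC_left complex_cnj_mult)

lemma cinner_scaleR_left: "cinner (r *\<^sub>R x) y = of_real r * cinner x y"
  for x :: "'a::complex_inner"
  by (simp add: scaleR_scaleC cinner_scaleC_left)

lemma cinner_scaleR_right: "cinner x (r *\<^sub>R y) = of_real r * cinner x y"
  for x :: "'a::complex_inner"
  by (simp add: scaleR_scaleC cinner_scaleC_right)

lemma cinner_diff_left: "cinner (x - y) z = cinner x z - cinner y z"
  for x :: "'a::complex_inner"
  by (metis cinner_add_left diff_add_cancel add_diff_cancel_right')

lemma cinner_diff_right: "cinner x (y - z) = cinner x y - cinner x z"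
  for x :: "'a::complex_inner"
  by (metis cinner_add_right diff_add_cancel add_diff_cancel_right')

lemma cinner_same: "cinner x x = of_real ((norm x)\<^sup>2)"
  for x :: "'a::complex_inner"
proof (rule complex_eqI)
  show "Re (cinner x x) = Re (of_real ((norm x)\<^sup>2))"
    by (simp add: norm_eq_sqrt_cinner cinner_ge_zero)
  have "Im (cinner x x) = - Im (cinner x x)"
    by (metis cinner_commute cnj.simps(2))
  then show "Im (cinner x x) = Im (of_real ((norm x)\<^sup>2))"
    by simp
qed

lemma Re_cinner_commute: "Re (cinner x y) = Re (cinner y x)"
  for x :: "'a::complex_inner"
  by (metis cinner_commute cnj.simps(1))

lemma norm_add_power2: "(norm (x + y))\<^sup>2 = (norm x)\<^sup>2 + 2 * Re (cinner x y) + (norm y)\<^sup>2"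
  for x :: "'a::complex_inner"
proof -
  have "of_real ((norm (x + y))\<^sup>2) = cinner (x + y) (x + y)"
    by (simp only: cinner_same)
  also have "\<dots> = cinner x x + cinner x y + cinner y x + cinner y y"
    by (simp add: cinner_add_left cinner_add_right)
  finally have "Re (of_real ((norm (x + y))\<^sup>2)) = Re (cinner x x + cinner x y + cinner y x + cinner y y)"
    by simp
  then show ?thesis
    by (simp add: cinner_same Re_cinner_commute[of y x])
qed

text \<open>Complex homogeneity comes from the inner product: the squared norm picks up the factor
  \<open>c * cnj c\<close>, the squared modulus.\<close>

lemma norm_scaleC: "norm (c *\<^sub>C x) = cmod c * norm x"
  for x :: "'a::complex_inner"
proof -
  have "complex_of_real ((norm (c *\<^sub>C x))\<^sup>2) = (c * cnj c) * cinner x x"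
    by (simp only: cinner_same[symmetric] cinner_scaleC_left cinner_scaleC_right mult_ac)
  also have "\<dots> = of_real ((cmod c * norm x)\<^sup>2)"
    by (simp add: cinner_same complex_norm_square[symmetric] power_mult_distrib)
  finally have "(norm (c *\<^sub>C x))\<^sup>2 = (cmod c * norm x)\<^sup>2"
    using of_real_eq_iff by blast
  then show ?thesis
    by simp
qed

text \<open>The triangle inequality is already an axiom of the norm, so expanding its square bounds
  the real part of the product. Rotating \<open>x\<close> by a phase turns this into a bound on the
  modulus.\<close>

lemma cinner_Cauchy_Schwarz: "cmod (cinner x y) \<le> norm x * norm y"
  for x :: "'a::complex_inner"
proof -
  have re: "Re (cinner u v) \<le> norm u * norm v" for u v :: 'a
  proof -
    have "(norm (u + v))\<^sup>2 \<le> (norm u + norm v)\<^sup>2"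
      by (intro power_mono norm_triangle_ineq) simp
    then show ?thesis
      by (simp add: norm_add_power2 power2_sum)
  qed
  \<comment> \<open>The phase that makes the product real and nonnegative. For a zero product
    \<open>sgn\<close> returns 0, so in general only \<open>cmod c \<le> 1\<close> holds.\<close>
  define c where "c = cnj (sgn (cinner x y))"
  have "c * cinner x y = of_real (cmod (cinner x y))"
    unfolding c_def
    by (cases "cinner x y = 0")
      (simp_all add: sgn_eq field_simps complex_norm_square[symmetric] power2_eq_square)
  then have "cmod (cinner x y) = Re (cinner (c *\<^sub>C x) y)"
    by (simp add: cinner_scaleC_left)
  also have "\<dots> \<le> cmod c * norm x * norm y"
    using re[of "c *\<^sub>C x" y] by (simp add: norm_scaleC)
  also have "\<dots> \<le> norm x * norm y"
    by (simp add: c_def norm_sgn)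
  finally show ?thesis .
qed

text \<open>Adjoints are accessible only through inner products, so identities about them are proved
  by this test.\<close>

lemma cinner_ext:
  fixes y z :: "'a::complex_inner"
  assumes "\<And>x. cinner x y = cinner x z"
  shows "y = z"
  using assms[of "y - z"] cinner_eq_zero_iff[of "y - z"] by (simp add: cinner_diff_right)

lemma bounded_linear_scaleC: "bounded_linear (\<lambda>x::'a::complex_inner. c *\<^sub>C x)"
proof (rule bounded_linear_intro)
  show "c *\<^sub>C (r *\<^sub>R x) = r *\<^sub>R c *\<^sub>C x" for r and x :: 'a
    by (simp add: scaleR_scaleC scaleC_scaleC mult.commute)
  show "norm (c *\<^sub>C x) \<le> norm x * cmod c" for x :: 'a
    by (simp add: norm_scaleC)
qed (rule scaleC_add_right)

lemma bounded_linear_cinner_left: "bounded_linear (\<lambda>x::'a::complex_inner. cinner x y)"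
proof (rule bounded_linear_intro[where K = "norm y"])
  show "cinner (r *\<^sub>R x) y = r *\<^sub>R cinner x y" for r and x :: 'a
    by (simp add: cinner_scaleR_left scaleR_conv_of_real)
qed (auto simp: cinner_add_left cinner_Cauchy_Schwarz)

section \<open>Riesz representation and adjoints\<close>

text \<open>
  The representing vector minimises \<open>J x = \<parallel>x\<parallel>\<^sup>2 - 2 f x\<close>: the parallelogram law gives
  \<open>\<parallel>x - y\<parallel>\<^sup>2 = 2 J x + 2 J y - 4 J ((x + y) / 2)\<close>, so minimising sequences are Cauchy.
\<close>

lemma Riesz_representation_Re:
  fixes f :: "'a::chilbert_space \<Rightarrow> real"
  assumes f: "bounded_linear f"
  shows "\<exists>z. \<forall>x. f x = Re (cinner x z)"
proof -
  interpret f: bounded_linear f by (rule f)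
  define J where "J x = (norm x)\<^sup>2 - 2 * f x" for x
  define m where "m = (INF x. J x)"
  \<comment> \<open>Completing the square in \<open>norm x\<close> bounds \<open>J\<close> from
    below, so \<open>m\<close> is a genuine infimum.\<close>
  have "- (onorm f)\<^sup>2 \<le> J x" for x
  proof -
    have "f x \<le> onorm f * norm x"
      using onorm[OF f, of x] by simp
    moreover have "0 \<le> (norm x - onorm f)\<^sup>2"
      by simp
    ultimately show ?thesis
      unfolding J_def power2_diff by (simp add: mult.commute)
  qed
  then have bdd: "bdd_below (range J)"
    by (intro bdd_belowI2)
  have m_le: "m \<le> J x" for x
    unfolding m_def by (rule cINF_lower[OF bdd]) simp
  have "\<exists>x. J x < m + inverse (real (Suc n))" for n
    using cINF_less_iff[OF UNIV_not_empty bdd, of "m + inverse (real (Suc n))"]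
    by (auto simp: m_def)
  then obtain X where X: "\<And>n. J (X n) < m + inverse (real (Suc n))"
    by metis
  have gap: "(norm (x - y))\<^sup>2 \<le> 2 * (J x - m) + 2 * (J y - m)" for x y
  proof -
    have "(norm ((1/2) *\<^sub>R (x + y)))\<^sup>2 = (norm (x + y))\<^sup>2 / 4"
      by (simp add: power_divide)
    moreover have "f ((1/2) *\<^sub>R (x + y)) = (f x + f y) / 2"
      by (simp only: f.scaleR f.add) simp
    ultimately have "4 * J ((1/2) *\<^sub>R (x + y)) = (norm (x + y))\<^sup>2 - 4 * (f x + f y)"
      unfolding J_def by (simp only:) (simp add: field_simps)
    moreover have "(norm (x + y))\<^sup>2 + (norm (x - y))\<^sup>2 = 2 * (norm x)\<^sup>2 + 2 * (norm y)\<^sup>2"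
      using norm_add_power2[of x y] norm_add_power2[of x "- y"]
        cinner_scaleR_right[of x "-1" y] by simp
    ultimately have "(norm (x - y))\<^sup>2 = 2 * J x + 2 * J y - 4 * J ((1/2) *\<^sub>R (x + y))"
      unfolding J_def by simp
    then show ?thesis
      using m_le[of "(1/2) *\<^sub>R (x + y)"] by simp
  qed
  have "Cauchy X"
  proof (rule metric_CauchyI)
    fix e :: real
    assume "0 < e"
    \<comment> \<open>\<open>gap\<close> adds two excesses over \<open>m\<close> with weight 2 each,
      so a quarter of \<open>e\<^sup>2\<close> for each is enough.\<close>
    then obtain N where N: "inverse (real (Suc N)) < e\<^sup>2 / 4"
      using reals_Archimedean[of "e\<^sup>2 / 4"] by auto
    have close: "J (X n) - m < e\<^sup>2 / 4" if "n \<ge> N" for n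
    proof -
      have "inverse (real (Suc n)) \<le> inverse (real (Suc N))"
        using that by (intro le_imp_inverse_le) auto
      then show ?thesis
        using X[of n] N by linarith
    qed
    have "dist (X i) (X j) < e" if "i \<ge> N" "j \<ge> N" for i j
    proof (rule power2_less_imp_less)
      show "(dist (X i) (X j))\<^sup>2 < e\<^sup>2"
        unfolding dist_norm
        by (rule le_less_trans[OF gap])
          (use close[OF that(1)] close[OF that(2)] in argo)
    qed (use \<open>0 < e\<close> in simp)
    then show "\<exists>M. \<forall>i\<ge>M. \<forall>j\<ge>M. dist (X i) (X j) < e"
      by blast
  qed
  then obtain z where z: "X \<longlonglongrightarrow> z"
    using Cauchy_convergent convergent_def by blast
  have "(\<lambda>n. J (X n)) \<longlonglongrightarrow> J z"
    unfolding J_def by (intro tendsto_intros z f.tendsto)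
  moreover have "(\<lambda>n. m + inverse (real (Suc n))) \<longlonglongrightarrow> m"
    using LIMSEQ_inverse_real_of_nat_add by simp
  ultimately have "J z \<le> m"
    by (rule LIMSEQ_le) (use X in \<open>auto intro: less_imp_le\<close>)
  then have minimal: "J z \<le> J x" for x
    using m_le[of x] by linarith
  have "f x = Re (cinner x z)" for x
  proof -
    \<comment> \<open>Moving from \<open>z\<close> to \<open>z + t *\<^sub>R x\<close> changes
      \<open>J\<close> by a quadratic in \<open>t\<close> with linear coefficient
      \<open>2 * d\<close>; minimality forces \<open>d = 0\<close>.\<close>
    define d where "d = Re (cinner x z) - f x"
    have quad: "0 \<le> t\<^sup>2 * (norm x)\<^sup>2 + 2 * t * d" for t
      using minimal[of "z + t *\<^sub>R x"] norm_add_power2[of z "t *\<^sub>R x"]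
      by (simp add: J_def d_def f.add f.scaleR cinner_scaleR_right Re_cinner_commute[of z x]
          power_mult_distrib algebra_simps)
    \<comment> \<open>The summand 1 covers \<open>x = 0\<close>. At \<open>t = - s * d\<close> the
      change of \<open>J\<close> is at most \<open>- s * d\<^sup>2\<close>.\<close>
    define s where "s = 1 / (1 + (norm x)\<^sup>2)"
    have s: "0 < s" "s * (norm x)\<^sup>2 \<le> 1"
      by (simp_all add: s_def add_pos_nonneg field_simps)
    have "0 \<le> s * d\<^sup>2 * (s * (norm x)\<^sup>2 - 2)"
      using quad[of "- s * d"] by (simp add: power2_eq_square algebra_simps)
    moreover have "s * d\<^sup>2 * (s * (norm x)\<^sup>2 - 2) \<le> s * d\<^sup>2 * (-1)"
      using s by (intro mult_left_mono) auto
    ultimately have "s * d\<^sup>2 \<le> 0"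
      by linarith
    then have "d = 0"
      using s(1) by (simp add: mult_le_0_iff)
    then show ?thesis
      by (simp add: d_def)
  qed
  then show ?thesis
    by blast
qed

section \<open>Bounded complex-linear operators, their adjoints and Cartesian parts\<close>

lemma bounded_clinearD:
  assumes "bounded_clinear T"
  shows "bounded_linear T" "T (c *\<^sub>C x) = c *\<^sub>C T x"
  using assms by (auto simp: bounded_clinear_def)

lemma bounded_clinear_scaleC:
  assumes "bounded_clinear T"
  shows "bounded_clinear (\<lambda>x. c *\<^sub>C T x)"
  unfolding bounded_clinear_def
  using bounded_linear_compose[OF bounded_linear_scaleC bounded_clinearD(1)[OF assms]]
  by (auto simp: bounded_clinearD(2)[OF assms] scaleC_scaleC mult.commute)

lemma bounded_clinear_diff_scaleC:
  assumes "bounded_clinear T"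
  shows "bounded_clinear (\<lambda>x. T x - c *\<^sub>C x)"
proof -
  have "T (d *\<^sub>C x) - c *\<^sub>C d *\<^sub>C x = d *\<^sub>C (T x - c *\<^sub>C x)" for d x
    using scaleC_add_right[of d "T x - c *\<^sub>C x" "c *\<^sub>C x"]
    by (simp add: bounded_clinearD(2)[OF assms] scaleC_scaleC mult.commute)
  then show ?thesis
    unfolding bounded_clinear_def
    by (auto intro: bounded_linear_sub bounded_clinearD(1)[OF assms] bounded_linear_scaleC)
qed

lemma cinner_cadjoint:
  fixes T :: "'a::chilbert_space \<Rightarrow> 'a"
  assumes T: "bounded_clinear T"
  shows "cinner (T x) y = cinner x (cadjoint T y)"
proof -
  have "\<exists>z. \<forall>x. cinner (T x) y = cinner x z" for y
  proof -
    have "bounded_linear (\<lambda>x. Re (cinner (T x) y))"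
      by (intro bounded_linear_compose[OF bounded_linear_Re]
          bounded_linear_compose[OF bounded_linear_cinner_left] bounded_clinearD(1)[OF T])
    then obtain z where z: "\<And>x. Re (cinner (T x) y) = Re (cinner x z)"
      using Riesz_representation_Re by blast
    \<comment> \<open>The real representation evaluated at \<open>\<i> *\<^sub>C x\<close> yields
      the imaginary parts, because \<open>T\<close> is complex-linear.\<close>
    have "Im (cinner (T x) y) = Im (cinner x z)" for x
      using z[of "\<i> *\<^sub>C x"] by (simp add: bounded_clinearD(2)[OF T] cinner_scaleC_left)
    with z show ?thesis
      by (intro exI[of _ z] allI complex_eqI) auto
  qed
  \<comment> \<open>Choosing a representing vector for each \<open>y\<close> gives an operator, so
    the \<open>SOME\<close> in \<open>cadjoint\<close> has a witness.\<close>
  then have "\<exists>S. \<forall>x y. cinner (T x) y = cinner x (S y)"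
    by metis
  then have "\<forall>x y. cinner (T x) y = cinner x (cadjoint T y)"
    unfolding cadjoint_def by (rule someI_ex)
  then show ?thesis
    by blast
qed

lemma cadjoint_scaleC:
  fixes T :: "'a::chilbert_space \<Rightarrow> 'a"
  assumes "bounded_clinear T"
  shows "cadjoint (\<lambda>x. c *\<^sub>C T x) y = cnj c *\<^sub>C cadjoint T y"
  by (rule cinner_ext)
    (simp add: cinner_cadjoint[OF bounded_clinear_scaleC[OF assms], symmetric]
      cinner_cadjoint[OF assms, symmetric] cinner_scaleC_left cinner_scaleC_right)

text \<open>Linearity follows by testing against all vectors. For the norm,
  \<open>z = cadjoint T y\<close> satisfies \<open>(norm z)\<^sup>2 = cinner (T z) y\<close>, and
  Cauchy-Schwarz leaves one factor \<open>norm z\<close> to cancel when it is nonzero.\<close>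

lemma bounded_linear_cadjoint:
  fixes T :: "'a::chilbert_space \<Rightarrow> 'a"
  assumes T: "bounded_clinear T"
  shows "bounded_linear (cadjoint T)"
proof (rule bounded_linear_intro)
  note adj = cinner_cadjoint[OF T, symmetric]
  show "cadjoint T (x + y) = cadjoint T x + cadjoint T y" for x y
    by (rule cinner_ext) (simp add: adj cinner_add_right)
  show "cadjoint T (r *\<^sub>R x) = r *\<^sub>R cadjoint T x" for r x
    by (rule cinner_ext) (simp add: adj cinner_scaleR_right)
  show "norm (cadjoint T y) \<le> norm y * onorm T" for y
  proof (cases "cadjoint T y = 0")
    case True
    then show ?thesis
      by (simp add: onorm_pos_le bounded_clinearD(1)[OF T])
  next
    case False
    let ?z = "cadjoint T y"
    have "cinner (T ?z) y = of_real ((norm ?z)\<^sup>2)"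
      by (simp only: cinner_cadjoint[OF T] cinner_same)
    then have "(norm ?z)\<^sup>2 \<le> norm (T ?z) * norm y"
      using cinner_Cauchy_Schwarz[of "T ?z" y] by (simp del: of_real_power)
    also have "\<dots> \<le> onorm T * norm ?z * norm y"
      by (intro mult_right_mono onorm bounded_clinearD(1)[OF T]) simp
    finally show ?thesis
      using False by (simp add: power2_eq_square mult.assoc mult.left_commute)
        (simp add: mult.commute)
  qed
qed

lemma bounded_linear_Re_op:
  fixes T :: "'a::chilbert_space \<Rightarrow> 'a"
  assumes "bounded_clinear T"
  shows "bounded_linear (Re_op T)"
  unfolding Re_op_def
  by (intro bounded_linear_compose[OF bounded_linear_scaleC] bounded_linear_add
      bounded_clinearD(1)[OF assms] bounded_linear_cadjoint[OF assms])

text \<open>The adjoint has the conjugate quadratic form, so averaging leaves the real part.\<close>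

lemma cinner_Re_op:
  fixes T :: "'a::chilbert_space \<Rightarrow> 'a"
  assumes "bounded_clinear T"
  shows "cinner (Re_op T x) x = of_real (Re (cinner (T x) x))"
proof -
  have "cinner (cadjoint T x) x = cnj (cinner (T x) x)"
    by (metis cinner_cadjoint[OF assms] cinner_commute)
  then show ?thesis
    by (simp add: Re_op_def cinner_scaleC_left cinner_add_left complex_add_cnj)
qed

text \<open>Identifies the two expressions whose norms occur in the bound. After pairing with
  \<open>y\<close> only complex arithmetic remains.\<close>

lemma Re_op_scaleC_cnj:
  fixes T :: "'a::chilbert_space \<Rightarrow> 'a"
  assumes "bounded_clinear T"
  shows "Re_op (\<lambda>x. cnj \<mu> *\<^sub>C T x) x = Re \<mu> *\<^sub>R Re_op T x + Im \<mu> *\<^sub>R Im_op T x"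
proof (rule cinner_ext)
  fix y
  have inverse_2i: "1 / (2 * \<i>) = - \<i> / 2"
    by (simp add: field_simps)
  show "cinner y (Re_op (\<lambda>x. cnj \<mu> *\<^sub>C T x) x)
      = cinner y (Re \<mu> *\<^sub>R Re_op T x + Im \<mu> *\<^sub>R Im_op T x)"
    unfolding Re_op_def Im_op_def inverse_2i
    by (simp add: cadjoint_scaleC[OF assms] cinner_scaleC_right
        cinner_scaleR_right cinner_add_right cinner_diff_right complex_eq_iff field_simps)
qed

section \<open>Radii\<close>

lemma norm_cinner_le_onorm:
  fixes A :: "'a::complex_inner \<Rightarrow> 'a"
  assumes "bounded_linear A" and "norm x = 1"
  shows "cmod (cinner (A x) x) \<le> onorm A"
  using cinner_Cauchy_Schwarz[of "A x" x] onorm[OF assms(1), of x] assms(2) by simp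

text \<open>A real supremum dominates its members once the set is bounded above; here
  \<open>onorm A\<close> is such a bound.\<close>

lemma norm_cinner_le_numerical_radius:
  assumes "bounded_linear A" and "norm x = 1"
  shows "cmod (cinner (A x) x) \<le> numerical_radius A"
  unfolding numerical_radius_def
proof (rule cSUP_upper)
  show "bdd_above ((\<lambda>x. cmod (cinner (A x) x)) ` {x. norm x = 1})"
    using norm_cinner_le_onorm[OF assms(1)] by (intro bdd_aboveI2) auto
qed (use assms(2) in simp)

text \<open>Normalising a nonzero vector makes the unit sphere nonempty, so a pointwise bound passes
  to the supremum.\<close>

lemma davis_wielandt_radius_le:
  fixes T :: "'a::complex_inner \<Rightarrow> 'a"
  assumes "\<exists>x::'a. x \<noteq> 0"
    and "\<And>x. norm x = 1 \<Longrightarrow> (cmod (cinner (T x) x))\<^sup>2 + norm (T x) ^ 4 \<le> B"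
  shows "davis_wielandt_radius T \<le> sqrt B"
proof -
  obtain x :: 'a where "x \<noteq> 0"
    using assms(1) by blast
  then have "norm (sgn x) = 1"
    by (simp add: norm_sgn)
  then have "{x::'a. norm x = 1} \<noteq> {}"
    by blast
  then show ?thesis
    unfolding davis_wielandt_radius_def by (rule cSUP_least) (simp add: assms(2))
qed

text \<open>Allows estimates of the radius to be squared. Boundedness of \<open>T\<close> keeps the
  supremum finite, so it dominates its value at one unit vector.\<close>

lemma davis_wielandt_radius_nonneg:
  fixes T :: "'a::complex_inner \<Rightarrow> 'a"
  assumes "\<exists>x::'a. x \<noteq> 0" and T: "bounded_linear T"
  shows "0 \<le> davis_wielandt_radius T"
proof -
  obtain x :: 'a where "x \<noteq> 0"
    using assms(1) by blast
  then have x: "norm (sgn x) = 1"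
    by (simp add: norm_sgn)
  let ?g = "\<lambda>x. sqrt ((cmod (cinner (T x) x))\<^sup>2 + norm (T x) ^ 4)"
  have bound: "?g y \<le> sqrt ((onorm T)\<^sup>2 + onorm T ^ 4)" if "norm y = 1" for y
    using norm_cinner_le_onorm[OF T that] onorm[OF T, of y] that
    by (intro real_sqrt_le_mono add_mono power_mono) auto
  have "bdd_above (?g ` {x. norm x = 1})"
    by (rule bdd_aboveI2) (use bound in blast)
  then have "?g (sgn x) \<le> davis_wielandt_radius T"
    unfolding davis_wielandt_radius_def by (rule cSUP_upper[rotated]) (use x in simp)
  moreover have "0 \<le> ?g (sgn x)"
    by simp
  ultimately show ?thesis
    by linarith
qed

section \<open>Bounds on the Davis-Wielandt radius\<close>

lemma davis_wielandt_pointwise_bound: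
  fixes T :: "'a::chilbert_space \<Rightarrow> 'a" and \<mu> :: complex
  defines "R \<equiv> Re_op (\<lambda>x. cnj \<mu> *\<^sub>C T x)"
  assumes T: "bounded_clinear T" and x: "norm x = 1"
  shows "(cmod (cinner (T x) x))\<^sup>2 + norm (T x) ^ 4 \<le>
      (2 * onorm R + onorm (\<lambda>x. cadjoint T (T x) - 2 *\<^sub>R R x))\<^sup>2
        + 2 * onorm R - (cmod \<mu>)\<^sup>2 + (numerical_radius (\<lambda>x. T x - \<mu> *\<^sub>C x))\<^sup>2"
proof -
  let ?N = "\<lambda>x. cadjoint T (T x) - 2 *\<^sub>R R x"
  define a where "a = cinner (T x) x"
  have xx: "cinner x x = 1"
    using x by (simp add: cinner_same)
  have R: "bounded_linear R"
    unfolding R_def by (intro bounded_linear_Re_op bounded_clinear_scaleC T)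
  have N: "bounded_linear ?N"
    by (intro bounded_linear_sub bounded_linear_compose[OF bounded_linear_scaleR_right R]
        bounded_linear_compose[OF bounded_linear_cadjoint[OF T]] bounded_clinearD(1)[OF T])
  have Rx: "cinner (R x) x = of_real (Re (cnj \<mu> * a))"
    by (simp add: R_def cinner_Re_op[OF bounded_clinear_scaleC[OF T]] cinner_scaleC_left a_def)
  \<comment> \<open>The quadratic form of \<open>R\<close> is real, so its modulus is an absolute
    value and bounds the signed value from above.\<close>
  then have R_le: "Re (cnj \<mu> * a) \<le> onorm R"
    using norm_cinner_le_onorm[OF R x] by (simp only: norm_of_real)
  have "cinner (cadjoint T (T x)) x = cnj (cinner (T x) (T x))"
    by (metis cinner_cadjoint[OF T] cinner_commute)
  then have "cinner (?N x) x = of_real ((norm (T x))\<^sup>2 - 2 * Re (cnj \<mu> * a))"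
    by (simp only: cinner_diff_left cinner_scaleR_left Rx cinner_same complex_cnj_complex_of_real
        of_real_diff of_real_mult)
  then have "(norm (T x))\<^sup>2 - 2 * Re (cnj \<mu> * a) \<le> onorm ?N"
    using norm_cinner_le_onorm[OF N x] by (simp only: norm_of_real)
  then have "(norm (T x))\<^sup>2 \<le> 2 * onorm R + onorm ?N"
    using R_le by linarith
  then have "((norm (T x))\<^sup>2)\<^sup>2 \<le> (2 * onorm R + onorm ?N)\<^sup>2"
    by (intro power_mono) auto
  then have Tx: "norm (T x) ^ 4 \<le> (2 * onorm R + onorm ?N)\<^sup>2"
    by simp
  have "cmod (a - \<mu>) \<le> numerical_radius (\<lambda>x. T x - \<mu> *\<^sub>C x)"
    using norm_cinner_le_numerical_radius[OF
        bounded_clinearD(1)[OF bounded_clinear_diff_scaleC[OF T, of \<mu>]] x]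
    by (simp add: cinner_diff_left cinner_scaleC_left xx a_def)
  then have "(cmod (a - \<mu>))\<^sup>2 \<le> (numerical_radius (\<lambda>x. T x - \<mu> *\<^sub>C x))\<^sup>2"
    by (intro power_mono) auto
  moreover have "(cmod a)\<^sup>2 = (cmod (a - \<mu>))\<^sup>2 + 2 * Re (cnj \<mu> * a) - (cmod \<mu>)\<^sup>2"
    unfolding cmod_power2 by (simp add: power2_eq_square algebra_simps)
  ultimately show ?thesis
    using Tx R_le by (simp add: a_def)
qed

text \<open>Each value under \<open>INF\<close> is at least the squared radius, so the values are
  bounded below and \<open>INF\<close> is a genuine infimum. \<open>nontrivial\<close> supplies the
  unit vectors for the suprema.\<close>

theorem theorem2p21:
  fixes T :: "'a::chilbert_space \<Rightarrow> 'a"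
  assumes nontrivial: "\<exists>x::'a. x \<noteq> 0"
    and bounded: "bounded_clinear T"
  shows "(davis_wielandt_radius T)\<^sup>2 \<le>
      (INF \<mu>::complex.
        (2 * onorm (\<lambda>x. Re \<mu> *\<^sub>R Re_op T x + Im \<mu> *\<^sub>R Im_op T x)
          + onorm (\<lambda>x. cadjoint T (T x) - 2 *\<^sub>R Re_op (\<lambda>y. cnj \<mu> *\<^sub>C T y) x))\<^sup>2
        + 2 * onorm (Re_op (\<lambda>x. cnj \<mu> *\<^sub>C T x))
        - (cmod \<mu>)\<^sup>2
        + (numerical_radius (\<lambda>x. T x - \<mu> *\<^sub>C x))\<^sup>2)
    \<and> davis_wielandt_radius T \<le> sqrt ((numerical_radius T)\<^sup>2 + onorm T ^ 4)"
proof
  have dw0: "0 \<le> davis_wielandt_radius T"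
    by (rule davis_wielandt_radius_nonneg[OF nontrivial bounded_clinearD(1)[OF bounded]])
  show "(davis_wielandt_radius T)\<^sup>2 \<le>
      (INF \<mu>::complex.
        (2 * onorm (\<lambda>x. Re \<mu> *\<^sub>R Re_op T x + Im \<mu> *\<^sub>R Im_op T x)
          + onorm (\<lambda>x. cadjoint T (T x) - 2 *\<^sub>R Re_op (\<lambda>y. cnj \<mu> *\<^sub>C T y) x))\<^sup>2
        + 2 * onorm (Re_op (\<lambda>x. cnj \<mu> *\<^sub>C T x))
        - (cmod \<mu>)\<^sup>2
        + (numerical_radius (\<lambda>x. T x - \<mu> *\<^sub>C x))\<^sup>2)"
    (is "_ \<le> (INF \<mu>. ?B \<mu>)")
  proof (rule cINF_greatest)
    fix \<mu> :: complex
    have "(\<lambda>x. Re \<mu> *\<^sub>R Re_op T x + Im \<mu> *\<^sub>R Im_op T x) = Re_op (\<lambda>x. cnj \<mu> *\<^sub>C T x)"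
      by (simp add: fun_eq_iff Re_op_scaleC_cnj[OF bounded])
    then have "(cmod (cinner (T x) x))\<^sup>2 + norm (T x) ^ 4 \<le> ?B \<mu>" if "norm x = 1" for x
      using davis_wielandt_pointwise_bound[OF bounded that, of \<mu>] by simp
    then have "davis_wielandt_radius T \<le> sqrt (?B \<mu>)"
      by (rule davis_wielandt_radius_le[OF nontrivial])
    \<comment> \<open>By \<open>dw0\<close> the radius equals its absolute value, so the square root
      can be removed by squaring.\<close>
    then show "(davis_wielandt_radius T)\<^sup>2 \<le> ?B \<mu>"
      using dw0 sqrt_ge_absD by force
  qed simp
  \<comment> \<open>Instead of putting \<open>\<mu> = 0\<close>, which leads to the norm of
    \<open>cadjoint T\<close> composed with \<open>T\<close>, the two summands are bounded
    separately at each unit vector.\<close>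
  show "davis_wielandt_radius T \<le> sqrt ((numerical_radius T)\<^sup>2 + onorm T ^ 4)"
  proof (rule davis_wielandt_radius_le[OF nontrivial])
    fix x :: 'a
    assume x: "norm x = 1"
    note T = bounded_clinearD(1)[OF bounded]
    show "(cmod (cinner (T x) x))\<^sup>2 + norm (T x) ^ 4 \<le> (numerical_radius T)\<^sup>2 + onorm T ^ 4"
      using norm_cinner_le_numerical_radius[OF T x] onorm[OF T, of x] x
      by (intro add_mono power_mono) auto
  qed
qed

end
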